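(* For an integer $t\geq1$ set $N_{t,1}=3t^2+2t$, $N_{t,2}=3t^2+4t+1$, $N_{t,3}=3t^2+6t+2$, and consider $\Gamma_{t,1}=\mathrm{Cay}(\mathbb{Z}_{N_{t,1}},\{t,2t+1\})$, $\Gamma_{t,2}=\mathrm{Cay}(\mathbb{Z}_{N_{t,2}},\{t,2t+1\})$, $\Gamma_{t,3}=\mathrm{Cay}(\mathbb{Z}_{N_{t,3}},\{2t+1,t\})$, with $E_{t,1}=6t+1$, $E_{t,2}=6t+3$, $E_{t,3}=2t+1$. Then for each $i\in\{1,2,3\}$, $\Gamma_{t,i}$ is tight, $\mathrm{c}(N_{t,i})=E_{t,i}$ (the maximum of $\mathrm{c}(N)$ over $N\in I_{t,i}$, $N\ne 3k^2$), and for every minimum distance diagram $\mathcal{H}$ of $\Gamma_{t,i}$ and every integer $m\ge1$, the $m$-extension $m\mathcal{H}$ is tight if and only if $m\le E_{t,i}$.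
   Context: A $2$--Cayley digraph is $\mathrm{Cay}(\mathrm{G},\{a,b\})$ with $\mathrm{G}$ a finite Abelian group, $a,b\in\mathrm{G}\setminus\{0\}$ generating it; vertices $\mathrm{G}$, arcs $g\to g+a$, $g\to g+b$. $\mathrm{lb}(N)=\lceil\sqrt{3N}\rceil-2$; a $2$--Cayley digraph of order $N$ is tight if its diameter equals $\mathrm{lb}(N)$. A minimum distance diagram of $\mathrm{Cay}(\mathrm{G},\{a,b\})$ is a map $\psi:\mathrm{G}\to\mathbb{N}^2$ with $\psi(\eta)=(i,j)$, $ia+jb=\eta$, $i+j$ minimal, image closed under coordinatewise smaller vectors in $\mathbb{N}^2$. For integers $0\le w<l$, $0\le y<h$, the L-shape $\mathrm{L}(l,h,w,y)=\{(i,j)\in\mathbb{Z}^2:0\le i<l,0\le j<h\}\setminus\{(i,j):l-w\le i<l,h-y\le j<h\}$ has area $lh-wy$ and diameter $l+h-\min\{w,y\}-2$ (which equals the digraph's diameter when the L-shape is the image of a minimum distance diagram of it); it is tight if its diameter equals $\mathrm{lb}$ of its area; $m\mathrm{L}(l,h,w,y)=\mathrm{L}(ml,mh,mw,my)$ (the $m$-extension). For $N\ne 3k^2$, $\mathrm{c}(N)=\lfloor 1/(\lceil\sqrt{3N}\rceil-\sqrt{3N})\rfloor$. The intervals are $I_{t,1}=[3t^2+1,3t^2+2t]$, $I_{t,2}=[3t^2+2t+1,3t^2+4t+1]$, $I_{t,3}=[3t^2+4t+2,3(t+1)^2]$. *)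

theory Defs
  imports
    Complex_Main
    "HOL-Algebra.Generated_Groups"
    "HOL-Algebra.Elementary_Groups"
    "Graph_Theory.Pair_Digraph"
    "Graph_Theory.Shortest_Path"
begin

text \<open>Cayley digraphs on two generators. HOL-Algebra writes groups multiplicatively, so the
  vector (i, j) labels the vertex that the additive notation writes as i a + j b.\<close>

definition cay2 :: "('a, 'm) monoid_scheme \<Rightarrow> 'a \<Rightarrow> 'a \<Rightarrow> 'a pair_pre_digraph" where
  "cay2 G a b = \<lparr> pverts = carrier G, parcs = {(g, g \<otimes>\<^bsub>G\<^esub> s) | g s. g \<in> carrier G \<and> s \<in> {a, b}} \<rparr>"

definition is_2cayley :: "('a, 'm) monoid_scheme \<Rightarrow> 'a \<Rightarrow> 'a \<Rightarrow> bool" where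
  "is_2cayley G a b \<longleftrightarrow>
     comm_group G \<and> finite (carrier G) \<and>
     a \<in> carrier G - {\<one>\<^bsub>G\<^esub>} \<and> b \<in> carrier G - {\<one>\<^bsub>G\<^esub>} \<and>
     generate G {a, b} = carrier G"

text \<open>Unit arc weights turn the shortest-path cost into the directed distance; it is infinite
  for unreachable vertices, and hence so is the diameter of a digraph that is not strongly
  connected.\<close>

definition diameter :: "'a pair_pre_digraph \<Rightarrow> ereal" where
  "diameter D =
     (SUP (u, v) \<in> pverts D \<times> pverts D. wf_digraph.\<mu> (with_proj D) (\<lambda>_. 1) u v)"

definition lb :: "int \<Rightarrow> int" where
  "lb N = \<lceil>sqrt (3 * real_of_int N)\<rceil> - 2"

definition tight_2cayley :: "('a, 'm) monoid_scheme \<Rightarrow> 'a \<Rightarrow> 'a \<Rightarrow> bool" where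
  "tight_2cayley G a b \<longleftrightarrow>
     is_2cayley G a b \<and> diameter (cay2 G a b) = ereal (real_of_int (lb (int (order G))))"

definition is_mdd ::
  "('a, 'm) monoid_scheme \<Rightarrow> 'a \<Rightarrow> 'a \<Rightarrow> ('a \<Rightarrow> nat \<times> nat) \<Rightarrow> bool" where
  "is_mdd G a b \<psi> \<longleftrightarrow>
     (\<forall>\<eta> \<in> carrier G. \<forall>i j. \<psi> \<eta> = (i, j) \<longrightarrow>
        a [^]\<^bsub>G\<^esub> i \<otimes>\<^bsub>G\<^esub> b [^]\<^bsub>G\<^esub> j = \<eta> \<and>
        (\<forall>i' j'. a [^]\<^bsub>G\<^esub> i' \<otimes>\<^bsub>G\<^esub> b [^]\<^bsub>G\<^esub> j' = \<eta> \<longrightarrow> i + j \<le> i' + j')) \<and>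
     (\<forall>i j i' j'. (i, j) \<in> \<psi> ` carrier G \<longrightarrow> i' \<le> i \<longrightarrow> j' \<le> j \<longrightarrow>
        (i', j') \<in> \<psi> ` carrier G)"

text \<open>An L-shape is given by its parameters (l, h, w, y). A region of the plane determines
  them, except that a rectangle has representations with w = 0 and any y, and vice versa;
  area and diameter, also after an extension, do not depend on that choice.\<close>

type_synonym lparams = "int \<times> int \<times> int \<times> int"

fun lparams_ok :: "lparams \<Rightarrow> bool" where
  "lparams_ok (l, h, w, y) \<longleftrightarrow> 0 \<le> w \<and> w < l \<and> 0 \<le> y \<and> y < h"

fun lshape :: "lparams \<Rightarrow> (int \<times> int) set" where
  "lshape (l, h, w, y) =
     {(i, j). 0 \<le> i \<and> i < l \<and> 0 \<le> j \<and> j < h} -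
     {(i, j). l - w \<le> i \<and> i < l \<and> h - y \<le> j \<and> j < h}"

fun lshape_area :: "lparams \<Rightarrow> int" where
  "lshape_area (l, h, w, y) = l * h - w * y"

fun lshape_diameter :: "lparams \<Rightarrow> int" where
  "lshape_diameter (l, h, w, y) = l + h - min w y - 2"

definition lshape_tight :: "lparams \<Rightarrow> bool" where
  "lshape_tight P \<longleftrightarrow> lshape_diameter P = lb (lshape_area P)"

fun extension :: "nat \<Rightarrow> lparams \<Rightarrow> lparams" where
  "extension m (l, h, w, y) = (int m * l, int m * h, int m * w, int m * y)"

definition mdd_lshape ::
  "('a, 'm) monoid_scheme \<Rightarrow> ('a \<Rightarrow> nat \<times> nat) \<Rightarrow> lparams \<Rightarrow> bool" where
  "mdd_lshape G \<psi> P \<longleftrightarrow>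
     lparams_ok P \<and> map_prod int int ` \<psi> ` carrier G = lshape P"

text \<open>Only meaningful when N is not of the form 3 k^2; otherwise the denominator is 0.\<close>

definition ext_coeff :: "int \<Rightarrow> int" where
  "ext_coeff N = \<lfloor>1 / (real_of_int \<lceil>sqrt (3 * real_of_int N)\<rceil> - sqrt (3 * real_of_int N))\<rfloor>"

text \<open>The three families; the index i ranges over 1, 2, 3.\<close>

definition fam_interval :: "nat \<Rightarrow> nat \<Rightarrow> nat set" where
  "fam_interval t i =
     (if i = 1 then {3 * t^2 + 1 .. 3 * t^2 + 2 * t}
      else if i = 2 then {3 * t^2 + 2 * t + 1 .. 3 * t^2 + 4 * t + 1}
      else {3 * t^2 + 4 * t + 2 .. 3 * (t + 1)^2})"

definition fam_N :: "nat \<Rightarrow> nat \<Rightarrow> nat" where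
  "fam_N t i =
     (if i = 1 then 3 * t^2 + 2 * t
      else if i = 2 then 3 * t^2 + 4 * t + 1
      else 3 * t^2 + 6 * t + 2)"

definition fam_a :: "nat \<Rightarrow> nat \<Rightarrow> int" where
  "fam_a t i = (if i = 1 \<or> i = 2 then int t else 2 * int t + 1)"

definition fam_b :: "nat \<Rightarrow> nat \<Rightarrow> int" where
  "fam_b t i = (if i = 1 \<or> i = 2 then 2 * int t + 1 else int t)"

definition fam_E :: "nat \<Rightarrow> nat \<Rightarrow> nat" where
  "fam_E t i = (if i = 1 then 6 * t + 1 else if i = 2 then 6 * t + 3 else 2 * t + 1)"

end

theory Submission
  imports Defs
begin

text \<open>Suppose \<open>l a = y b\<close> and \<open>h b = w a\<close> in a group of order \<open>l h - w y\<close>. A vector outside the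
  L-shape \<open>L(l, h, w, y)\<close> can then be replaced by a strictly shorter one with the same label, so
  every shortest vector lies in the L-shape. By counting, the L-shape contains exactly one vector
  per group element. Hence it is the image of every minimum distance diagram, and it determines
  the diameter of the digraph. The three families satisfy this with \<open>w = y = t\<close> and
  \<open>(l, h) = (2t + 1, 2t)\<close>, \<open>(2t + 1, 2t + 1)\<close>, \<open>(2t + 2, 2t + 1)\<close>. For
  \<open>c = 3t + i = \<lceil>\<surd>(3 N)\<rceil>\<close> one has \<open>l + h - t = c\<close>, so the \<open>m\<close>-extension is tight if and only if
  \<open>m c = \<lceil>m \<surd>(3 N)\<rceil>\<close>, i.e. \<open>m (c - \<surd>(3 N)) < 1\<close>.\<close>

section \<open>Distances in Cayley digraphs\<close>

context comm_group
begin

lemma cay2_simps [simp]: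
  "pverts (cay2 G a b) = carrier G"
  "(g, g') \<in> parcs (cay2 G a b) \<longleftrightarrow> g \<in> carrier G \<and> (g' = g \<otimes> a \<or> g' = g \<otimes> b)"
  by (auto simp: cay2_def)

lemma wf_digraph_cay2:
  assumes "a \<in> carrier G" "b \<in> carrier G"
  shows "wf_digraph (with_proj (cay2 G a b))"
  using assms by unfold_locales (auto simp: cay2_def)

text \<open>In an Abelian group the order of the arcs of a walk is irrelevant: only the numbers
  \<open>i\<close> and \<open>j\<close> of arcs of either kind matter.\<close>

lemma awalk_cay2D:
  assumes "a \<in> carrier G" "b \<in> carrier G"
    and "pre_digraph.awalk (with_proj (cay2 G a b)) u p v"
  shows "\<exists>i j. i + j = length p \<and> v = u \<otimes> (a [^] i \<otimes> b [^] j)"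
  using assms(3)
proof (induction p arbitrary: u)
  case Nil
  then have "u \<in> carrier G" "u = v"
    by (auto simp: pre_digraph.awalk_def pre_digraph.cas.simps cay2_def)
  then show ?case by (intro exI[of _ 0]) simp
next
  case (Cons e es)
  interpret wf_digraph "with_proj (cay2 G a b)"
    using assms by (intro wf_digraph_cay2)
  from Cons.prems have e: "e \<in> parcs (cay2 G a b)" "u = fst e" "awalk (snd e) es v"
    by (auto simp: awalk_Cons_iff)
  from Cons.IH[OF e(3)] obtain i j where
    ij: "i + j = length es" "v = snd e \<otimes> (a [^] i \<otimes> b [^] j)" by blast
  from e(1,2) have u: "u \<in> carrier G" and s: "snd e = u \<otimes> a \<or> snd e = u \<otimes> b"
    by (auto simp: cay2_def)
  from s show ?case
  proof
    assume "snd e = u \<otimes> a"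
    then have "v = u \<otimes> (a [^] Suc i \<otimes> b [^] j)"
      using ij(2) u assms(1,2) by (simp add: m_ac)
    then show ?thesis using ij(1) by (metis add_Suc length_Cons)
  next
    assume "snd e = u \<otimes> b"
    then have "v = u \<otimes> (a [^] i \<otimes> b [^] Suc j)"
      using ij(2) u assms(1,2) by (simp add: m_ac)
    then show ?thesis using ij(1) by (metis add_Suc_right length_Cons)
  qed
qed

text \<open>The walk takes all arcs labelled \<open>a\<close> first and then those labelled
  \<open>b\<close>.\<close>

lemma awalk_cay2I:
  assumes "a \<in> carrier G" "b \<in> carrier G" "u \<in> carrier G"
  shows "\<exists>p. pre_digraph.awalk (with_proj (cay2 G a b)) u p (u \<otimes> (a [^] i \<otimes> b [^] j))
    \<and> length p = i + j"
proof -
  interpret wf_digraph "with_proj (cay2 G a b)"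
    using assms by (intro wf_digraph_cay2)
  have b_walk: "\<exists>p. awalk u p (u \<otimes> b [^] j) \<and> length p = j" if "u \<in> carrier G" for u
    using that
  proof (induction j arbitrary: u)
    case 0
    then show ?case by (intro exI[of _ "[]"]) (simp add: awalk_Nil_iff)
  next
    case (Suc j)
    have "u \<otimes> b \<in> carrier G" using Suc.prems assms by simp
    from Suc.IH[OF this] obtain p where "awalk (u \<otimes> b) p (u \<otimes> b \<otimes> b [^] j)" "length p = j"
      by blast
    moreover have "(u, u \<otimes> b) \<in> parcs (cay2 G a b)" using Suc.prems by (auto simp: cay2_def)
    moreover have "u \<otimes> b \<otimes> b [^] j = u \<otimes> b [^] Suc j"
      using Suc.prems assms by (simp add: m_ac)
    ultimately show ?case
      by (intro exI[of _ "(u, u \<otimes> b) # p"]) (simp add: awalk_Cons_iff)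
  qed
  show ?thesis
    using assms(3)
  proof (induction i arbitrary: u)
    case 0
    then show ?case using b_walk[of u] assms by simp
  next
    case (Suc i)
    have "u \<otimes> a \<in> carrier G" using Suc.prems assms by simp
    from Suc.IH[OF this] obtain p where
      "awalk (u \<otimes> a) p (u \<otimes> a \<otimes> (a [^] i \<otimes> b [^] j))" "length p = i + j" by blast
    moreover have "(u, u \<otimes> a) \<in> parcs (cay2 G a b)" using Suc.prems by (auto simp: cay2_def)
    moreover have "u \<otimes> a \<otimes> (a [^] i \<otimes> b [^] j) = u \<otimes> (a [^] Suc i \<otimes> b [^] j)"
      using Suc.prems assms by (simp add: m_ac)
    ultimately show ?case
      by (intro exI[of _ "(u, u \<otimes> a) # p"]) (simp add: awalk_Cons_iff)
  qed
qed

text \<open>By cancellation of \<open>u\<close>, every walk to the target yields a vector with the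
  label of \<open>(i, j)\<close>; hence the distance is the same from every
  \<open>u\<close>.\<close>

lemma distance_cay2:
  assumes "a \<in> carrier G" "b \<in> carrier G" "u \<in> carrier G"
    and min: "\<And>i' j'. a [^] (i'::nat) \<otimes> b [^] (j'::nat) = a [^] i \<otimes> b [^] j \<Longrightarrow> i + j \<le> i' + j'"
  shows "wf_digraph.\<mu> (with_proj (cay2 G a b)) (\<lambda>_. 1) u (u \<otimes> (a [^] i \<otimes> b [^] j))
    = ereal (real (i + j))"
proof -
  interpret wf_digraph "with_proj (cay2 G a b)"
    using assms by (intro wf_digraph_cay2)
  let ?v = "u \<otimes> (a [^] i \<otimes> b [^] j)"
  have cost: "awalk_cost (\<lambda>_. 1) p = real (length p)" for p :: "('a \<times> 'a) list"
    by (induction p) auto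
  obtain p where p: "awalk u p ?v" "length p = i + j"
    using awalk_cay2I[OF assms(1-3)] by blast
  show ?thesis unfolding \<mu>_def
  proof (rule antisym)
    show "(INF p\<in>{p. awalk u p ?v}. ereal (awalk_cost (\<lambda>_. 1) p)) \<le> ereal (real (i + j))"
      using p by (intro INF_lower2[of p]) (auto simp: cost)
    show "ereal (real (i + j)) \<le> (INF p\<in>{p. awalk u p ?v}. ereal (awalk_cost (\<lambda>_. 1) p))"
    proof (rule INF_greatest)
      fix q assume "q \<in> {p. awalk u p ?v}"
      then obtain i' j' where ij': "i' + j' = length q" "?v = u \<otimes> (a [^] i' \<otimes> b [^] j')"
        using awalk_cay2D[OF assms(1,2)] by blast
      then have "a [^] i' \<otimes> b [^] j' = a [^] i \<otimes> b [^] j"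
        using assms(1-3) by (metis Units_eq Units_l_cancel m_closed nat_pow_closed)
      then show "ereal (real (i + j)) \<le> ereal (awalk_cost (\<lambda>_. 1) q)"
        using min ij'(1) by (simp add: cost) (metis of_nat_add of_nat_le_iff)
    qed
  qed
qed

end

lemma mem_lshape:
  "(i, j) \<in> lshape (l, h, w, y) \<longleftrightarrow>
    0 \<le> i \<and> i < l \<and> 0 \<le> j \<and> j < h \<and> (i < l - w \<or> j < h - y)"
  by auto

section \<open>Abelian groups with an L-shaped diagram\<close>

text \<open>\<open>pow_l\<close> and \<open>pow_h\<close> are the relations \<open>(l, -y)\<close>
  and \<open>(-w, h)\<close>. The bounds \<open>yl\<close> and \<open>wh\<close> make their
  coordinate sums positive; \<open>wl\<close> and \<open>yh\<close> keep the notch smaller than the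
  rectangle in both directions.\<close>

locale lshape_group = comm_group +
  fixes a b and l h w y :: nat
  assumes a_closed [simp]: "a \<in> carrier G" and b_closed [simp]: "b \<in> carrier G"
    and wl: "w < l" and yh: "y < h" and wh: "w < h" and yl: "y < l"
    and finite_carrier: "finite (carrier G)"
    and order_eq: "order G = l * h - w * y"
    and pow_l: "a [^] l = b [^] y"
    and pow_h: "b [^] h = a [^] w"
    and span: "\<And>\<eta>. \<eta> \<in> carrier G \<Longrightarrow> \<exists>i j. a [^] (i::nat) \<otimes> b [^] (j::nat) = \<eta>"
begin

definition "val = (\<lambda>(i::nat, j::nat). a [^] i \<otimes> b [^] j)"

text \<open>The natural-number form of \<open>lshape\<close>, suited to exponents; by
  \<open>wl\<close> and \<open>yh\<close> the subtractions do not truncate.\<close>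

definition "L = {..<l} \<times> {..<h} - {l - w..<l} \<times> {h - y..<h}"

lemma val_closed [simp]: "val p \<in> carrier G"
  by (cases p) (simp add: val_def)

lemma mem_L: "(i, j) \<in> L \<longleftrightarrow> i < l \<and> j < h \<and> (i < l - w \<or> j < h - y)"
  by (auto simp: L_def)

lemma card_L: "card L = l * h - w * y"
proof -
  have "{l - w..<l} \<times> {h - y..<h} \<subseteq> {..<l} \<times> {..<h}" by auto
  then show ?thesis unfolding L_def
    by (subst card_Diff_subset) (use wl yh in \<open>auto simp: card_cartesian_product\<close>)
qed

lemma finite_L: "finite L"
  by (simp add: L_def)

text \<open>The relations \<open>(l, -y)\<close> and \<open>(-w, h)\<close> add up to
  \<open>(l - w, h - y)\<close>. To avoid inverses, the product is multiplied by
  \<open>a [^] w \<otimes> b [^] y\<close>, which is cancelled at the end.\<close>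

lemma corner: "a [^] (l - w) \<otimes> b [^] (h - y) = \<one>"
proof -
  have "(a [^] (l - w) \<otimes> b [^] (h - y)) \<otimes> (a [^] w \<otimes> b [^] y)
      = (a [^] (l - w) \<otimes> a [^] w) \<otimes> (b [^] (h - y) \<otimes> b [^] y)"
    by (simp add: m_ac)
  also have "\<dots> = a [^] l \<otimes> b [^] h"
    using wl yh by (simp add: nat_pow_mult)
  also have "\<dots> = a [^] w \<otimes> b [^] y"
    by (simp add: pow_l pow_h m_comm)
  finally show ?thesis
    by (metis a_closed b_closed l_cancel_one m_closed nat_pow_closed m_comm)
qed

text \<open>The three reductions subtract \<open>(l, -y)\<close>, \<open>(-w, h)\<close> and their sum, all of which are
  relations of the group with positive coordinate sum.\<close>

lemma descent:
  assumes "(i, j) \<notin> L"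
  shows "\<exists>i' j'. val (i', j') = val (i, j) \<and> i' + j' < i + j"
proof -
  \<comment> \<open>A vector outside \<open>L\<close> lies to the right of the rectangle, above it,
    or in the notch.\<close>
  consider "i \<ge> l" | "j \<ge> h" | "i \<ge> l - w" "j \<ge> h - y"
    using assms by (force simp: mem_L)
  then show ?thesis
  proof cases
    case 1
    have "val (i, j) = (a [^] (i - l) \<otimes> a [^] l) \<otimes> b [^] j"
      using 1 by (simp add: val_def nat_pow_mult)
    also have "\<dots> = val (i - l, y + j)"
      by (simp add: val_def pow_l m_assoc nat_pow_mult)
    finally show ?thesis using 1 yl by (intro exI[of _ "i - l"] exI[of _ "y + j"]) auto
  next
    case 2
    have "val (i, j) = a [^] i \<otimes> (b [^] h \<otimes> b [^] (j - h))"
      using 2 by (simp add: val_def nat_pow_mult)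
    also have "\<dots> = val (i + w, j - h)"
      by (simp add: val_def pow_h nat_pow_mult flip: m_assoc)
    finally show ?thesis using 2 wh by (intro exI[of _ "i + w"] exI[of _ "j - h"]) auto
  next
    case 3
    have "val (i, j) = (a [^] (i - (l - w)) \<otimes> a [^] (l - w)) \<otimes> (b [^] (j - (h - y)) \<otimes> b [^] (h - y))"
      using 3 by (simp add: val_def nat_pow_mult)
    also have "\<dots> = val (i - (l - w), j - (h - y)) \<otimes> (a [^] (l - w) \<otimes> b [^] (h - y))"
      by (simp add: val_def m_ac)
    also have "\<dots> = val (i - (l - w), j - (h - y))" by (simp add: corner)
    finally show ?thesis using 3 wl
      by (intro exI[of _ "i - (l - w)"] exI[of _ "j - (h - y)"]) auto
  qed
qed

text \<open>Every use of \<open>descent\<close> lowers the coordinate sum, so repeating it ends in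
  \<open>L\<close>. The bound on the sum is carried along for \<open>L_minimal\<close>.\<close>

lemma reduce_to_L: "\<exists>i' j'. (i', j') \<in> L \<and> val (i', j') = val (i, j) \<and> i' + j' \<le> i + j"
proof (induction "i + j" arbitrary: i j rule: less_induct)
  case less
  show ?case
  proof (cases "(i, j) \<in> L")
    case False
    then obtain i' j' where *: "val (i', j') = val (i, j)" "i' + j' < i + j"
      using descent by blast
    then show ?thesis using less[of i' j'] by fastforce
  qed blast
qed

lemma val_L: "val ` L = carrier G"
proof
  show "carrier G \<subseteq> val ` L"
  proof
    fix \<eta> assume "\<eta> \<in> carrier G"
    then obtain i j :: nat where "a [^] i \<otimes> b [^] j = \<eta>" using span by blast
    then have "val (i, j) = \<eta>" by (simp add: val_def)
    then show "\<eta> \<in> val ` L" using reduce_to_L[of i j] by (metis imageI)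
  qed
qed auto

text \<open>A surjection between finite sets of equal size is injective.\<close>

lemma inj_on_val_L: "inj_on val L"
  using finite_L by (rule eq_card_imp_inj_on) (use order_eq in \<open>simp add: val_L card_L order_def\<close>)

text \<open>Reducing a competitor into \<open>L\<close> never increases its sum and, by injectivity,
  arrives at \<open>(i, j)\<close> itself.\<close>

lemma L_minimal:
  assumes "(i, j) \<in> L" "val (i', j') = val (i, j)"
  shows "i + j \<le> i' + j'"
proof -
  obtain i'' j'' where "(i'', j'') \<in> L" "val (i'', j'') = val (i', j')" "i'' + j'' \<le> i' + j'"
    using reduce_to_L by blast
  moreover from this have "(i'', j'') = (i, j)"
    using assms by (intro inj_onD[OF inj_on_val_L]) auto
  ultimately show ?thesis by simp
qed

lemma minimal_in_L:
  assumes "\<And>i' j'. val (i', j') = val (i, j) \<Longrightarrow> i + j \<le> i' + j'"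
  shows "(i, j) \<in> L"
  using assms descent[of i j] by (metis not_less)

text \<open>\<open>val\<close> undoes \<psi>, so \<psi> is injective; its values are shortest
  vectors, so they lie in \<open>L\<close>; equal cardinalities then force equality.\<close>

lemma mdd_image:
  assumes "is_mdd G a b \<psi>"
  shows "\<psi> ` carrier G = L"
proof -
  have val_\<psi>: "val (\<psi> \<eta>) = \<eta>" if "\<eta> \<in> carrier G" for \<eta>
    using assms that unfolding is_mdd_def val_def by (metis case_prod_unfold prod.collapse)
  have sub: "\<psi> ` carrier G \<subseteq> L"
  proof safe
    fix i j \<eta> assume \<eta>: "\<eta> \<in> carrier G" "(i, j) = \<psi> \<eta>"
    then have "val (i, j) = \<eta>" using val_\<psi> by simp
    moreover have "\<forall>i' j'. a [^] i' \<otimes> b [^] j' = \<eta> \<longrightarrow> i + j \<le> i' + j'"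
      using assms \<eta> unfolding is_mdd_def by metis
    ultimately show "(i, j) \<in> L"
      by (intro minimal_in_L) (simp add: val_def)
  qed
  have "inj_on \<psi> (carrier G)" using val_\<psi> by (metis inj_onI)
  then have "card (\<psi> ` carrier G) = card L"
    using order_eq by (simp add: card_image card_L order_def)
  then show ?thesis using sub finite_L by (metis card_subset_eq)
qed

lemma L_sum_le: "(i, j) \<in> L \<Longrightarrow> i + j \<le> l + h - min w y - 2"
  by (auto simp: mem_L min_def)

text \<open>The two outer corners \<open>(l - w - 1, h - 1)\<close> and
  \<open>(l - 1, h - y - 1)\<close> have sums \<open>l + h - w - 2\<close> and
  \<open>l + h - y - 2\<close>; the larger one is taken.\<close>

lemma L_sum_attained: "\<exists>i j. (i, j) \<in> L \<and> i + j = l + h - min w y - 2"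
proof (cases "w \<le> y")
  case True
  then show ?thesis using wl yh
    by (intro exI[of _ "l - w - 1"] exI[of _ "h - 1"]) (auto simp: mem_L)
next
  case False
  then show ?thesis using wl yh
    by (intro exI[of _ "l - 1"] exI[of _ "h - y - 1"]) (auto simp: mem_L)
qed

lemma diameter_cay2: "diameter (cay2 G a b) = ereal (real (l + h - min w y - 2))"
proof -
  have dist: "wf_digraph.\<mu> (with_proj (cay2 G a b)) (\<lambda>_. 1) u (u \<otimes> val (i, j)) = ereal (real (i + j))"
    if "u \<in> carrier G" "(i, j) \<in> L" for u i j
    using distance_cay2[of a b u i j] L_minimal[OF that(2)] that(1) by (simp add: val_def)
  show ?thesis unfolding diameter_def
  proof (rule antisym)
    show "(SUP (u, v) \<in> pverts (cay2 G a b) \<times> pverts (cay2 G a b).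
        wf_digraph.\<mu> (with_proj (cay2 G a b)) (\<lambda>_. 1) u v) \<le> ereal (real (l + h - min w y - 2))"
    proof (rule SUP_least, clarify)
      fix u v assume "u \<in> pverts (cay2 G a b)" "v \<in> pverts (cay2 G a b)"
      then have uv: "u \<in> carrier G" "v \<in> carrier G" by (auto simp: cay2_def)
      \<comment> \<open>Translating by \<open>inv u\<close> turns the pair \<open>(u, v)\<close>
        into a single label, which has a shortest vector in \<open>L\<close>.\<close>
      then have "inv u \<otimes> v \<in> val ` L" by (simp add: val_L)
      then obtain i j where ij: "(i, j) \<in> L" "inv u \<otimes> v = val (i, j)" by auto
      then have "v = u \<otimes> val (i, j)" using uv by (metis inv_solve_left val_closed)
      then show "wf_digraph.\<mu> (with_proj (cay2 G a b)) (\<lambda>_. 1) u v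
          \<le> ereal (real (l + h - min w y - 2))"
        using dist[OF uv(1) ij(1)] L_sum_le[OF ij(1)] by (simp only: ereal_less_eq of_nat_le_iff)
    qed
    obtain i j where ij: "(i, j) \<in> L" "i + j = l + h - min w y - 2"
      using L_sum_attained by blast
    have "wf_digraph.\<mu> (with_proj (cay2 G a b)) (\<lambda>_. 1) \<one> (\<one> \<otimes> val (i, j))
        = ereal (real (l + h - min w y - 2))"
      using dist[OF one_closed ij(1)] ij(2) by simp
    then show "ereal (real (l + h - min w y - 2)) \<le>
        (SUP (u, v) \<in> pverts (cay2 G a b) \<times> pverts (cay2 G a b).
        wf_digraph.\<mu> (with_proj (cay2 G a b)) (\<lambda>_. 1) u v)"
      by (intro SUP_upper2[of "(\<one>, \<one> \<otimes> val (i, j))"]) (simp_all add: cay2_def)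
  qed
qed

lemma generate_ab: "generate G {a, b} = carrier G"
proof
  interpret H: subgroup "generate G {a, b}" G
    by (rule generate_is_subgroup) simp
  have gen: "a \<in> generate G {a, b}" "b \<in> generate G {a, b}"
    by (auto intro: generate.incl)
  have pow: "x [^] (n::nat) \<in> generate G {a, b}" if "x \<in> generate G {a, b}" for x n
    using that by (induction n) auto
  show "carrier G \<subseteq> generate G {a, b}"
    using span pow gen H.m_closed by blast
qed (simp add: generate_incl)

lemma map_int_L: "map_prod int int ` L = lshape (int l, int h, int w, int y)"
proof -
  have iff: "(int i, int j) \<in> lshape (int l, int h, int w, int y) \<longleftrightarrow> (i, j) \<in> L" for i j
    using wl yh by (auto simp: mem_L mem_lshape)
  show ?thesis
  proof (intro equalityI subsetI)
    fix p assume "p \<in> map_prod int int ` L"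
    then show "p \<in> lshape (int l, int h, int w, int y)" by (auto simp: iff simp del: lshape.simps)
  next
    fix p assume p: "p \<in> lshape (int l, int h, int w, int y)"
    then have "p = map_prod int int (nat (fst p), nat (snd p))" by auto
    with p iff show "p \<in> map_prod int int ` L" by (metis image_eqI map_prod_simp)
  qed
qed

end

text \<open>A nonempty notch excludes rectangles, the only regions with several representations.
  Each parameter is recovered by testing points at the boundary.\<close>

lemma lshape_inject:
  assumes "lparams_ok (l, h, w, y)" "lparams_ok (l', h', w', y')" "0 < w" "0 < y"
    and eq: "lshape (l', h', w', y') = lshape (l, h, w, y)"
  shows "(l', h', w', y') = (l, h, w, y)"
proof -
  have iff: "0 \<le> i \<and> i < l' \<and> 0 \<le> j \<and> j < h' \<and> (i < l' - w' \<or> j < h' - y') \<longleftrightarrow>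
      0 \<le> i \<and> i < l \<and> 0 \<le> j \<and> j < h \<and> (i < l - w \<or> j < h - y)" for i j
    by (simp only: mem_lshape[symmetric] eq)
  \<comment> \<open>The bottom row avoids the notch and has length \<open>l\<close>; likewise the
    leftmost column has length \<open>h\<close>.\<close>
  have l: "l' = l"
    using assms(1,2) iff[of "l - 1" 0] iff[of "l' - 1" 0] iff[of l 0] iff[of l' 0] by auto
  have h: "h' = h"
    using assms(1,2) iff[of 0 "h - 1"] iff[of 0 "h' - 1"] iff[of 0 h] iff[of 0 h'] by auto
  have pos: "0 < w'" "0 < y'"
    using assms iff[of "l - 1" "h - 1"] l h by auto
  \<comment> \<open>In the top row, \<open>l - w\<close> is the first missing abscissa; the
    rightmost column gives \<open>y\<close> in the same way.\<close>
  have "w' = w"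
    using assms pos l h iff[of "l - w" "h - 1"] iff[of "l - w'" "h - 1"] by auto
  moreover have "y' = y"
    using assms pos l h iff[of "l - 1" "h - y"] iff[of "l - 1" "h - y'"] by auto
  ultimately show ?thesis using l h by simp
qed

section \<open>The gap between $\sqrt{3N}$ and its ceiling\<close>

lemma ceiling_sqrt_eq:
  fixes c N :: int
  assumes "1 \<le> c" "(c - 1)^2 < 3 * N" "3 * N \<le> c^2"
  shows "\<lceil>sqrt (3 * real_of_int N)\<rceil> = c"
proof (rule ceiling_unique)
  have "real_of_int ((c - 1)^2) < real_of_int (3 * N)"
    using assms(2) by (simp only: of_int_less_iff)
  then show "real_of_int c - 1 < sqrt (3 * real_of_int N)"
    by (intro real_less_rsqrt) simp
  have "real_of_int (3 * N) \<le> real_of_int (c^2)"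
    using assms(3) by (simp only: of_int_le_iff)
  then show "sqrt (3 * real_of_int N) \<le> real_of_int c"
    using assms(1) by (intro real_le_lsqrt) simp_all
qed

text \<open>Otherwise \<open>3 * N\<close> would be the square of \<open>3 * \<bar>k\<bar>\<close>,
  strictly between two consecutive squares.\<close>

lemma not_three_squares:
  fixes c N :: int
  assumes "1 \<le> c" "(c - 1)^2 < 3 * N" "3 * N < c^2"
  shows "N \<noteq> 3 * k^2"
proof
  assume "N = 3 * k^2"
  then have "3 * N = (3 * \<bar>k\<bar>)^2" by (simp add: power_mult_distrib)
  then have "c - 1 < 3 * \<bar>k\<bar>" "3 * \<bar>k\<bar> < c"
    using assms by (metis abs_ge_zero power_less_imp_less_base mult_nonneg_nonneg zero_le_numeral,
        metis power_less_imp_less_base order_trans zero_le_one)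
  then show False by simp
qed

text \<open>With \<open>s = \<surd>(3 N)\<close> and \<open>3 N = c\<^sup>2 - d\<close>, the gap is \<open>c - s = d / (c + s)\<close>, where
  \<open>2 c - 1 < c + s < 2 c\<close>.\<close>

lemma gap_bounds:
  fixes c N d E :: int and g :: real
  assumes "1 \<le> c" "(c - 1)^2 < 3 * N" "3 * N = c^2 - d" "0 < d" "0 \<le> E"
    and "d * E \<le> 2 * c - 1" "2 * c \<le> d * (E + 1)"
  defines "g \<equiv> real_of_int c - sqrt (3 * real_of_int N)"
  shows "0 < g" "E * g < 1" "1 < (E + 1) * g"
proof -
  define s where "s = sqrt (3 * real_of_int N)"
  have g: "g = c - s" by (simp add: g_def s_def)
  have "0 \<le> 3 * N" using assms(2) zero_le_power2[of "c - 1"] by linarith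
  then have "s^2 = real_of_int (3 * N)" by (simp add: s_def)
  also have "\<dots> = real_of_int (c^2 - d)" by (simp only: assms(3))
  finally have prod: "g * (c + s) = d"
    by (simp add: g algebra_simps power2_eq_square)
  have "real_of_int ((c - 1)^2) < real_of_int (3 * N)"
    using assms(2) by (simp only: of_int_less_iff)
  then have s1: "c - 1 < s" unfolding s_def by (intro real_less_rsqrt) simp
  have "real_of_int (3 * N) < real_of_int (c^2)"
    using assms(3,4) by (simp only: of_int_less_iff)
  then have s2: "s < c" unfolding s_def using assms(1) by (intro real_less_lsqrt) simp_all
  have pos: "0 < c + s" using s1 assms(1) by linarith
  show g0: "0 < g" using s2 g by simp
  \<comment> \<open>Multiplication by \<open>c + s\<close> turns \<open>E * g\<close> into
    \<open>d * E\<close> and 1 into \<open>c + s\<close>, so integer bounds on \<open>d * E\<close>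
    decide the comparison.\<close>
  have "real_of_int (d * E) \<le> real_of_int (2 * c - 1)"
    using assms(6) by (simp only: of_int_le_iff)
  then have "d * real_of_int E < c + s" using s1 by simp
  then have "(E * g) * (c + s) < 1 * (c + s)"
    by (simp add: mult.assoc prod mult.commute[of _ "real_of_int d"])
  then show "E * g < 1" using pos mult_less_cancel_right_pos by blast
  have "real_of_int (2 * c) \<le> real_of_int (d * (E + 1))"
    using assms(7) by (simp only: of_int_le_iff)
  then have "c + s < d * real_of_int (E + 1)" using s2 by simp
  then have "1 * (c + s) < ((E + 1) * g) * (c + s)"
    by (simp add: mult.assoc prod mult.commute[of _ "real_of_int d"])
  then show "1 < (E + 1) * g" using pos mult_less_cancel_right_pos by blast
qed

text \<open>\<open>gap_bounds\<close> places the reciprocal of the gap strictly between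
  \<open>E\<close> and \<open>E + 1\<close>.\<close>

lemma ext_coeff_eq:
  fixes c N d E :: int
  assumes "1 \<le> c" "(c - 1)^2 < 3 * N" "3 * N = c^2 - d" "0 < d" "0 \<le> E"
    and "d * E \<le> 2 * c - 1" "2 * c \<le> d * (E + 1)"
  shows "ext_coeff N = E"
proof -
  have c: "\<lceil>sqrt (3 * real_of_int N)\<rceil> = c" using assms by (intro ceiling_sqrt_eq) auto
  note g = gap_bounds[OF assms]
  show ?thesis unfolding ext_coeff_def c
    using g by (intro floor_unique) (simp_all add: field_simps)
qed

text \<open>\<open>M\<close> and \<open>N\<close> share the ceiling \<open>c\<close>, so the larger
  number has the smaller gap. This locates the maximum over an interval at its largest admissible
  element.\<close>

lemma ext_coeff_mono:
  fixes c M N :: int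
  assumes "1 \<le> c" "(c - 1)^2 < 3 * M" "M \<le> N" "3 * N < c^2"
  shows "ext_coeff M \<le> ext_coeff N"
proof -
  have N: "(c - 1)^2 < 3 * N" and M: "3 * M \<le> c^2" using assms by linarith+
  have c: "\<lceil>sqrt (3 * real_of_int M)\<rceil> = c" "\<lceil>sqrt (3 * real_of_int N)\<rceil> = c"
    using assms N M by (auto intro!: ceiling_sqrt_eq)
  have "real_of_int (3 * N) < real_of_int (c^2)" using assms(4) by (simp only: of_int_less_iff)
  then have "sqrt (3 * real_of_int N) < c" using assms(1) by (intro real_less_lsqrt) simp_all
  moreover have "sqrt (3 * real_of_int M) \<le> sqrt (3 * real_of_int N)" using assms(3) by simp
  ultimately show ?thesis unfolding ext_coeff_def c
    by (intro floor_mono frac_le) auto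
qed

text \<open>The \<open>m\<close>-extension multiplies the area by the square of \<open>m\<close>,
  hence both \<open>c\<close> and \<open>s\<close> by \<open>m\<close>; rounding up still gives
  \<open>m * c\<close> as long as \<open>m\<close> times the gap stays below 1.\<close>

lemma lb_extension_iff:
  fixes c N d E :: int and m :: nat
  assumes "1 \<le> c" "(c - 1)^2 < 3 * N" "3 * N = c^2 - d" "0 < d" "0 \<le> E"
    and "d * E \<le> 2 * c - 1" "2 * c \<le> d * (E + 1)"
  shows "int m * c - 2 = lb (int m ^ 2 * N) \<longleftrightarrow> int m \<le> E"
proof -
  define s where "s = sqrt (3 * real_of_int N)"
  note g = gap_bounds[OF assms, folded s_def]
  have "sqrt (3 * real_of_int (int m ^ 2 * N)) = m * s"
    by (simp add: s_def real_sqrt_mult)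
  then have "int m * c - 2 = lb (int m ^ 2 * N) \<longleftrightarrow> \<lceil>m * s\<rceil> = int m * c"
    by (auto simp: lb_def)
  also have "\<dots> \<longleftrightarrow> m * (c - s) < 1"
  proof -
    \<comment> \<open>The upper half of the ceiling condition always holds, leaving only
      \<open>m * c - 1 < m * s\<close>.\<close>
    have "m * s \<le> m * real_of_int c" using g(1) by (intro mult_left_mono) auto
    then show ?thesis by (auto simp: ceiling_eq_iff algebra_simps)
  qed
  also have "\<dots> \<longleftrightarrow> int m \<le> E"
  proof
    assume "m * (c - s) < 1"
    then have "m * (c - s) < (E + 1) * (c - s)" using g(3) by linarith
    then have "real m < E + 1" using g(1) by (simp add: mult_less_cancel_right_pos)
    then show "int m \<le> E" by linarith
  next
    assume "int m \<le> E"
    then have "m * (c - s) \<le> E * (c - s)" using g(1) by (intro mult_right_mono) linarith+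
    then show "m * (c - s) < 1" using g(2) by linarith
  qed
  finally show ?thesis .
qed

section \<open>The three families\<close>

text \<open>The L-shape \<open>(2 * t, 2 * t, t, t)\<close> has area \<open>3 * t^2\<close> and
  meets the bound exactly; the families lengthen one or both of its sides by one or two
  units.\<close>

definition fam_l :: "nat \<Rightarrow> nat \<Rightarrow> nat" where
  "fam_l t i = (if i = 3 then 2 * t + 2 else 2 * t + 1)"

definition fam_h :: "nat \<Rightarrow> nat \<Rightarrow> nat" where
  "fam_h t i = (if i = 1 then 2 * t else 2 * t + 1)"

lemma fam_lshape_group:
  assumes "t \<ge> 1" "i \<in> {1, 2, 3}"
  shows "lshape_group (integer_mod_group (fam_N t i)) (fam_a t i) (fam_b t i)
    (fam_l t i) (fam_h t i) t t"
proof -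
  let ?N = "fam_N t i" and ?a = "fam_a t i" and ?b = "fam_b t i"
  interpret comm_group "integer_mod_group ?N" by simp
  have sq: "int t \<ge> 1" "int t * int t \<ge> int t" using assms(1) by simp_all
  have N: "?N > 0" and ab: "0 < ?a" "?a < int ?N" "0 < ?b" "?b < int ?N"
    using assms
    by (auto simp: fam_N_def fam_a_def fam_b_def power2_eq_square) (use sq in linarith)+
  have carrier: "carrier (integer_mod_group ?N) = {0..<int ?N}"
    using N by (simp add: carrier_integer_mod_group)
  have order: "?N = fam_l t i * fam_h t i - t * t"
    using assms(2) by (auto simp: fam_N_def fam_l_def fam_h_def power2_eq_square algebra_simps)
  \<comment> \<open>In each family one relation is an identity of integers, and in the other the two
    sides differ by exactly \<open>?N\<close>.\<close>
  have l: "(int (fam_l t i) * ?a) mod int ?N = (int t * ?b) mod int ?N"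
    and h: "(int (fam_h t i) * ?b) mod int ?N = (int t * ?a) mod int ?N"
    using assms(2)
    by (auto simp: mod_eq_dvd_iff fam_N_def fam_l_def fam_h_def fam_a_def fam_b_def
        power2_eq_square algebra_simps)
  \<comment> \<open>The generators are coprime, since
    \<open>(2 * t + 1) - 2 * t = 1\<close>.\<close>
  obtain u v :: int where uv: "u * ?a + v * ?b = 1"
  proof (cases "i = 3")
    case True
    then show thesis using that[of 1 "- 2"] by (simp add: fam_a_def fam_b_def)
  next
    case False
    then show thesis using that[of "- 2" 1] assms(2) by (auto simp: fam_a_def fam_b_def)
  qed
  have span: "\<exists>i j. (int i * ?a + int j * ?b) mod int ?N = \<eta>" if "0 \<le> \<eta>" "\<eta> < int ?N" for \<eta>
  proof -
    have "\<eta> = (\<eta> * (u * ?a + v * ?b)) mod int ?N" using that by (simp add: uv)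
    also have "\<dots> = ((\<eta> * u) * ?a + (\<eta> * v) * ?b) mod int ?N"
      by (simp add: algebra_simps)
    \<comment> \<open>One coefficient may be negative; reduction modulo \<open>?N\<close> makes both
      usable as natural exponents.\<close>
    also have "\<dots> = ((\<eta> * u) mod int ?N * ?a + (\<eta> * v) mod int ?N * ?b) mod int ?N"
      by (metis mod_add_cong mod_mult_left_eq)
    finally have "\<eta> = (int (nat ((\<eta> * u) mod int ?N)) * ?a + int (nat ((\<eta> * v) mod int ?N)) * ?b)
        mod int ?N"
      using N by simp
    then show ?thesis by metis
  qed
  show ?thesis
  proof
    show "?a \<in> carrier (integer_mod_group ?N)" "?b \<in> carrier (integer_mod_group ?N)"
      "finite (carrier (integer_mod_group ?N))"
      using ab by (simp_all add: carrier)
    show "t < fam_l t i" "t < fam_h t i"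
      using assms by (simp_all add: fam_l_def fam_h_def)
    show "order (integer_mod_group ?N) = fam_l t i * fam_h t i - t * t"
      unfolding order_def carrier using order by simp
    show "?a [^]\<^bsub>integer_mod_group ?N\<^esub> fam_l t i = ?b [^]\<^bsub>integer_mod_group ?N\<^esub> t"
      "?b [^]\<^bsub>integer_mod_group ?N\<^esub> fam_h t i = ?a [^]\<^bsub>integer_mod_group ?N\<^esub> t"
      using l h by simp_all
    show "\<exists>j k. ?a [^]\<^bsub>integer_mod_group ?N\<^esub> (j::nat) \<otimes>\<^bsub>integer_mod_group ?N\<^esub>
        ?b [^]\<^bsub>integer_mod_group ?N\<^esub> (k::nat) = \<eta>"
      if "\<eta> \<in> carrier (integer_mod_group ?N)" for \<eta>
      using that span[of \<eta>] by (simp add: carrier mod_add_eq)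
  qed
qed

theorem theorem6:
  fixes t i :: nat
  assumes "t \<ge> 1" and "i \<in> {1, 2, 3}"
  shows
    "tight_2cayley (integer_mod_group (fam_N t i)) (fam_a t i) (fam_b t i) \<and>
     ext_coeff (int (fam_N t i)) = int (fam_E t i) \<and>
     fam_N t i \<in> {N \<in> fam_interval t i. \<forall>k. N \<noteq> 3 * k^2} \<and>
     Max ((\<lambda>N. ext_coeff (int N)) ` {N \<in> fam_interval t i. \<forall>k. N \<noteq> 3 * k^2}) = int (fam_E t i) \<and>
     (\<forall>\<psi>. is_mdd (integer_mod_group (fam_N t i)) (fam_a t i) (fam_b t i) \<psi> \<longrightarrow>
        (\<exists>P. mdd_lshape (integer_mod_group (fam_N t i)) \<psi> P) \<and>
        (\<forall>P. mdd_lshape (integer_mod_group (fam_N t i)) \<psi> P \<longrightarrow>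
           (\<forall>m \<ge> 1. lshape_tight (extension m P) \<longleftrightarrow> m \<le> fam_E t i)))"
proof -
  let ?N = "fam_N t i" and ?a = "fam_a t i" and ?b = "fam_b t i" and ?E = "fam_E t i"
  let ?G = "integer_mod_group ?N" and ?l = "fam_l t i" and ?h = "fam_h t i"
  let ?S = "{N \<in> fam_interval t i. \<forall>k. N \<noteq> 3 * k^2}"
  interpret lshape_group ?G ?a ?b ?l ?h t t
    using assms by (rule fam_lshape_group)
  \<comment> \<open>\<open>c\<close> is the ceiling of the square root of \<open>3 * ?N\<close>, and
    \<open>d\<close> is the defect \<open>c^2 - 3 * ?N\<close>. In all three cases
    \<open>d * (?E + 1) = 2 * c\<close>.\<close>
  define c d where "c = 3 * int t + int i" and "d = (if i = 3 then 3 else 1 :: int)"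
  have c: "1 \<le> c" "(c - 1)^2 < 3 * int ?N" "3 * int ?N = c^2 - d" "0 < d" "0 \<le> int ?E"
    "d * int ?E \<le> 2 * c - 1" "2 * c \<le> d * (int ?E + 1)"
    using assms
    by (auto simp: c_def d_def fam_N_def fam_E_def power2_eq_square algebra_simps)
  have lhc: "int ?l + int ?h - int t = c"
    and area: "int ?l * int ?h - int t * int t = int ?N"
    using assms(2)
    by (auto simp: c_def fam_l_def fam_h_def fam_N_def power2_eq_square algebra_simps)
  have NS: "?N \<in> ?S"
  proof -
    have "int ?N \<noteq> 3 * (int k)^2" for k
      using c by (intro not_three_squares[of c]) auto
    then have "?N \<noteq> 3 * k^2" for k by (metis of_nat_mult of_nat_numeral of_nat_power)
    moreover have "?N \<in> fam_interval t i"
      using assms by (auto simp: fam_N_def fam_interval_def power2_eq_square algebra_simps)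
    ultimately show ?thesis by blast
  qed
  have E: "ext_coeff (int ?N) = int ?E" using c by (rule ext_coeff_eq)
  have le: "ext_coeff (int M) \<le> int ?E" if M: "M \<in> ?S" for M
  proof -
    \<comment> \<open>For \<open>i = 3\<close> the right end of the interval is three times a
      square; excluding it leaves \<open>?N\<close> as the largest element.\<close>
    have "M \<noteq> 3 * (t + 1)^2" using M by blast
    then have "M \<le> ?N" "(3 * t + (i - 1))^2 < 3 * M"
      using M assms
      by (auto simp: fam_N_def fam_interval_def power2_eq_square algebra_simps)
    moreover from this(2) have "int ((3 * t + (i - 1))^2) < int (3 * M)"
      by (simp only: of_nat_less_iff)
    then have "(c - 1)^2 < 3 * int M"
      using assms(2) by (auto simp: c_def add.commute)
    ultimately show ?thesis
      using ext_coeff_mono[of c "int M" "int ?N"] c E by simp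
  qed
  have fin: "finite ?S" by (rule finite_subset[of _ "fam_interval t i"]) (auto simp: fam_interval_def)
  have Max: "Max ((\<lambda>N. ext_coeff (int N)) ` ?S) = int ?E"
    using fin le NS E by (intro Max_eqI) (auto simp: image_iff intro!: bexI[of _ ?N])
  have lb: "lb (int ?N) = c - 2"
    using ceiling_sqrt_eq[of c "int ?N"] c by (simp add: lb_def)
  have order: "order ?G = ?N" using order_eq area by (simp add: of_nat_diff flip: of_nat_mult)
  have ab: "?a \<noteq> 0" "?b \<noteq> 0" using assms(1) by (auto simp: fam_a_def fam_b_def)
  have "int (?l + ?h - min t t - 2) = c - 2"
    using lhc wl yh by simp
  then have "real (?l + ?h - min t t - 2) = real_of_int (lb (int (order ?G)))"
    by (metis lb order of_int_of_nat_eq)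
  then have tight: "tight_2cayley ?G ?a ?b"
    using ab a_closed b_closed finite_carrier generate_ab diameter_cay2 comm_group_axioms
    by (simp add: tight_2cayley_def is_2cayley_def)
  have mdd: "(\<exists>P. mdd_lshape ?G \<psi> P) \<and>
      (\<forall>P. mdd_lshape ?G \<psi> P \<longrightarrow> (\<forall>m \<ge> 1. lshape_tight (extension m P) \<longleftrightarrow> m \<le> ?E))"
    if \<psi>: "is_mdd ?G ?a ?b \<psi>" for \<psi>
  proof -
    let ?P = "(int ?l, int ?h, int t, int t)"
    have image: "map_prod int int ` \<psi> ` carrier ?G = lshape ?P"
      using mdd_image[OF \<psi>] map_int_L by simp
    have ok: "lparams_ok ?P" using wl yh by simp
    \<comment> \<open>As \<open>t \<ge> 1\<close>, the notch is nonempty and the region determines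
      its parameters, so the claim for all \<open>P\<close> reduces to \<open>?P\<close>.\<close>
    have unique: "P = ?P" if "mdd_lshape ?G \<psi> P" for P
    proof -
      obtain l' h' w' y' where P: "P = (l', h', w', y')" by (cases P)
      have "lparams_ok P" "lshape P = lshape ?P" using that image by (simp_all only: mdd_lshape_def)
      then show ?thesis unfolding P using ok assms(1) by (intro lshape_inject) simp_all
    qed
    have "lshape_tight (extension m ?P) \<longleftrightarrow> m \<le> ?E" for m
    proof -
      have "lshape_diameter (extension m ?P) = int m * c - 2"
        by (simp add: algebra_simps flip: lhc)
      moreover have "lshape_area (extension m ?P) = int m ^ 2 * int ?N"
        by (simp add: algebra_simps power2_eq_square flip: area)
      ultimately show ?thesis
        using lb_extension_iff[OF c, of m] by (simp only: lshape_tight_def of_nat_le_iff)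
    qed
    moreover have "mdd_lshape ?G \<psi> ?P" using image ok by (simp add: mdd_lshape_def)
    ultimately show ?thesis using unique by blast
  qed
  show ?thesis using tight E NS Max mdd by blast
qed

end
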